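(* In the data markets game with joint externality and without any intervention ($\mathcal{T}_i(S)=0$ for all $i$ and $S$), there are instances in which no $\varepsilon$-pure Nash equilibrium exists for any $\varepsilon<1$.
   Context: Data markets game with joint externality: there are $n$ buyers and $k$ sellers. Each buyer $i$ simultaneously chooses a seller set $\gamma_i$ (a subset of the sellers, possibly empty); $S=(\gamma_1,\dots,\gamma_n)$. Buyer $i$'s expected net gain is $g_i(\gamma)\in[-1,1]$, with $g_i(\emptyset)=0$. The expected externality that buyer $i$ suffers from buyer $j\ne i$ is $e_{ij}(\gamma_i,\gamma_j)\ge0$, depending on both orders (where $\gamma_i$ is what $i$ buys and $\gamma_j$ is what $j$ buys), normalized so that the total externality $\sum_{j\ne i}e_{ji}(\gamma_i,\gamma_j)$ caused by buyer $i$ lies in $[0,1]$ for every $i$ and every profile. Without intervention, buyer $i$'s expected utility is $u_i(S)=g_i(\gamma_i)-\sum_{j\ne i}e_{ij}(\gamma_i,\gamma_j)$. A profile $S^q=(\gamma_1^q,\dots,\gamma_n^q)$ is an $\varepsilon$-pure Nash equilibrium if no buyer $i$ can increase her expected utility by more than $\varepsilon$ by unilaterally deviating from $\gamma_i^q$. *)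

theory Defs
  imports Complex_Main
begin

text \<open>
  Buyers are the naturals below \<open>n\<close>, sellers the naturals below \<open>k\<close>; a profile maps each
  buyer to the set of sellers she buys from, and its values at indices from \<open>n\<close> on are irrelevant.
\<close>

type_synonym profile = "nat \<Rightarrow> nat set"

definition profiles :: "nat \<Rightarrow> nat \<Rightarrow> profile set" where
  "profiles n k = {S. \<forall>i<n. S i \<subseteq> {..<k}}"

text \<open>
  \<open>g i A\<close> is the expected net gain of buyer \<open>i\<close> from the seller set \<open>A\<close>.
  \<open>e i j A B\<close> is the expected externality that \<open>i\<close> suffers from \<open>j\<close> when \<open>i\<close> buys from \<open>A\<close>
  and \<open>j\<close> buys from \<open>B\<close>: the sufferer always comes first, both in the indices and in the
  seller sets. The externality caused by \<open>i\<close> is therefore a sum over the first index.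
\<close>

definition data_market ::
  "nat \<Rightarrow> nat \<Rightarrow> (nat \<Rightarrow> nat set \<Rightarrow> real) \<Rightarrow> (nat \<Rightarrow> nat \<Rightarrow> nat set \<Rightarrow> nat set \<Rightarrow> real) \<Rightarrow> bool" where
  "data_market n k g e \<longleftrightarrow>
     (\<forall>i<n. \<forall>A. A \<subseteq> {..<k} \<longrightarrow> g i A \<in> {-1..1}) \<and>
     (\<forall>i<n. g i {} = 0) \<and>
     (\<forall>i<n. \<forall>j<n. \<forall>A B. i \<noteq> j \<longrightarrow> A \<subseteq> {..<k} \<longrightarrow> B \<subseteq> {..<k} \<longrightarrow> e i j A B \<ge> 0) \<and>
     (\<forall>S\<in>profiles n k. \<forall>i<n. (\<Sum>j\<in>{..<n} - {i}. e j i (S j) (S i)) \<in> {0..1})"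

text \<open>
  \<open>T i S\<close> is the amount the intervention charges buyer \<open>i\<close> under the profile \<open>S\<close>.
\<close>

definition utility ::
  "nat \<Rightarrow> (nat \<Rightarrow> nat set \<Rightarrow> real) \<Rightarrow> (nat \<Rightarrow> nat \<Rightarrow> nat set \<Rightarrow> nat set \<Rightarrow> real) \<Rightarrow>
   (nat \<Rightarrow> profile \<Rightarrow> real) \<Rightarrow> nat \<Rightarrow> profile \<Rightarrow> real" where
  "utility n g e T i S = g i (S i) - (\<Sum>j\<in>{..<n} - {i}. e i j (S i) (S j)) - T i S"

definition eps_pure_nash ::
  "nat \<Rightarrow> nat \<Rightarrow> (nat \<Rightarrow> profile \<Rightarrow> real) \<Rightarrow> real \<Rightarrow> profile \<Rightarrow> bool" where
  "eps_pure_nash n k u \<epsilon> S \<longleftrightarrow>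
     S \<in> profiles n k \<and>
     (\<forall>i<n. \<forall>A. A \<subseteq> {..<k} \<longrightarrow> u i (S(i := A)) - u i S \<le> \<epsilon>)"

end

theory Submission imports Defs begin

text \<open>
  Matching pennies: with one seller and zero gains, buyer \<open>0\<close> suffers one unit when the two
  purchases agree and buyer \<open>1\<close> when they differ. In every profile one of them suffers one unit
  and can escape all of it by switching.
\<close>

theorem proposition2:
  "\<exists>n k g e. data_market n k g e \<and>
     (\<forall>T. (\<forall>i<n. \<forall>S\<in>profiles n k. T i S = 0) \<longrightarrow>
       (\<forall>\<epsilon><1. \<not> (\<exists>S. eps_pure_nash n k (utility n g e T) \<epsilon> S)))"
proof -
  define g :: "nat \<Rightarrow> nat set \<Rightarrow> real" where "g = (\<lambda>i A. 0)"
  define e :: "nat \<Rightarrow> nat \<Rightarrow> nat set \<Rightarrow> nat set \<Rightarrow> real"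
    where "e = (\<lambda>i j A B. of_bool ((A = B) = (i = 0)))"
  have others: "{..<2} - {0} = {1::nat}" "{..<2} - {Suc 0} = {0::nat}"
    by auto
  \<comment> \<open>With two buyers, the externality that a buyer causes is a sum with a single
    term, an indicator, so it lies in [0,1].\<close>
  have "data_market 2 1 g e"
    unfolding data_market_def g_def e_def by (auto simp: less_2_cases_iff others simp del: sum_of_bool_eq)
  moreover have "\<not> eps_pure_nash 2 1 (utility 2 g e T) \<epsilon> S"
    if T: "\<forall>i<2. \<forall>S\<in>profiles 2 1. T i S = 0" and "\<epsilon> < 1" for T \<epsilon> S
  proof
    assume nash: "eps_pure_nash 2 1 (utility 2 g e T) \<epsilon> S"
    then have S: "S \<in> profiles 2 1"
      by (simp add: eps_pure_nash_def)
    \<comment> \<open>\<open>T\<close> is known to vanish only on \<open>profiles 2 1\<close>, hence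
      the condition on \<open>R\<close>; \<open>dev\<close> supplies it for the deviations.\<close>
    have u: "utility 2 g e T 0 R = - of_bool (R 0 = R 1)"
      "utility 2 g e T 1 R = - of_bool (R 0 \<noteq> R 1)" if "R \<in> profiles 2 1" for R
      using T that by (auto simp: utility_def g_def e_def others simp del: sum_of_bool_eq)
    have dev: "S(i := A) \<in> profiles 2 1" if "A \<subseteq> {..<1}" for i A
      using S that by (simp add: profiles_def)
    have no_gain: "utility 2 g e T i (S(i := A)) - utility 2 g e T i S \<le> \<epsilon>"
      if "i < 2" "A \<subseteq> {..<1}" for i A
      using nash that by (simp add: eps_pure_nash_def)
    show False
    proof (cases "S 0 = S 1")
      case True
      \<comment> \<open>Buyer \<open>0\<close> suffers and moves to the complement of
        \<open>S 1\<close>. Seller \<open>0\<close> lies in exactly one of the two sets, so they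
        differ and her utility rises from -1 to 0.\<close>
      define A :: "nat set" where "A = {..<1} - S 1"
      have "A \<subseteq> {..<1}" "A \<noteq> S 1"
        unfolding A_def by auto
      then show False
        using no_gain[of 0 A] True \<open>\<epsilon> < 1\<close> by (simp add: u dev S del: One_nat_def)
    next
      case False
      \<comment> \<open>Buyer \<open>1\<close> suffers and copies buyer \<open>0\<close>, again
        gaining 1 > \<epsilon>; the inclusion makes this an admissible deviation.\<close>
      have "S 0 \<subseteq> {..<1}"
        using S by (simp add: profiles_def)
      then show False
        using no_gain[of 1 "S 0"] False \<open>\<epsilon> < 1\<close> by (simp add: u dev S del: One_nat_def)
    qed
  qed
  ultimately show ?thesis
    by blast
qed

end
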